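(* Let $V=(v_{ij})\in(\mathbb R\cup\{\infty\})^{d\times n}$ be a matrix none of whose columns is identically $\infty$, and let $\Psi$ be a subgraph of the complete bipartite graph $[d]\times[n]$. The signed cells $\overline{\operatorname{thalf}}(V,\Psi_\epsilon)/\mathbb R\mathbf 1$, where $\epsilon$ ranges over all sign vectors in $\{+,-\}^n$, generate a piecewise linear decomposition of $\mathbb{TP}_{\min}^{d-1}$. Furthermore, a cell with graph $G$ in the covector decomposition of $\mathbb{TP}_{\min}^{d-1}$ by $V$ is contained in $\overline{\operatorname{thalf}}(V,\Psi_\epsilon)$ if and only if $\Psi_\epsilon\cap G$ has no isolated node in $[n]$.
   Context: $\mathbb T_{\min}=\mathbb R\cup\{\infty\}$; $\mathbb{TP}_{\min}^{d-1}$ is the quotient of $\mathbb T_{\min}^d\setminus\{(\infty,\dots,\infty)\}$ by $\mathbb R\mathbf 1$. Subgraphs of $[d]\times[n]$ are identified with arc sets; $v^{(j)}$ is the $j$th column of $V$. For $u\in\mathbb T_{\min}^d$, $\operatorname{supp}(u)=\{i:u_i\ne\infty\}$. Sectors: for $i\in\operatorname{supp}(u)$, $S_i(u)=\{z\in\mathbb R^d : z_\ell-z_i\le u_\ell-u_i\text{ for all }\ell\in\operatorname{supp}(u)\}$. For $K\subseteq[d]$ let $b^{(K)}\in\mathbb T_{\min}^d$ have $i$th entry $\infty$ if $i\in K$ and $0$ otherwise. Put $$\overline{S_i(u)}=S_i(u)\cup\bigcup_{K\in\mathcal K}\bigl(b^{(K)}+S_i(u)\bigr),$$ where $\mathcal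 K=\{A\cup B : A\in\mathcal A,\ B\in\mathcal B\}$, $\mathcal A=\{\emptyset\}\cup\{M\cup\{i\} : M\subseteq\operatorname{supp}(u)\}$, $\mathcal B=\{M : M\subseteq[d]\setminus\operatorname{supp}(u)\}$, and $+$ is elementwise addition. These sets are viewed modulo $\mathbb R\mathbf 1$ as subsets of $\mathbb{TP}_{\min}^{d-1}$ (discarding the all-$\infty$ vector). For $i\notin\operatorname{supp}(u)$ set $\overline{S_i(u)}=\emptyset$. For a subgraph $\Phi\subseteq[d]\times[n]$ put $\overline{\operatorname{thalf}}(V,\Phi)=\bigcap_{j\in[n]}\bigcup_{i:(i,j)\in\Phi}\overline{S_i(v^{(j)})}$. For $\epsilon\in\{+,-\}^n$ let $\Psi_\epsilon=\{(i,j)\in[d]\times[n] : ((i,j)\in\Psi\text{ and }\epsilon_j=+)\text{ or }((i,j)\notin\Psi\text{ and }\epsilon_j=-)\}$. A nonempty set $\overline{\operatorname{thalf}}(V,\Psi_\epsilon)$, as a subset of $\mathbb{TP}_{\min}^{d-1}$, is called a signed cell. Covector decomposition of $\mathbb{TP}_{\min}^{d-1}$ by $V$: the sectors $S_i(u)$, $i\in\operatorname{supp}(u)$, are the maximal cells of a polyhedral complex $\Delta(u)$ covering $\mathbb R^d$ (its cells are intersections of nonempty families of sectors of $u$), and the covector decomposition of $\mathbb R^d$ by a matrix is the common refinement of the complexes of its columns (the single cell $\mathbb R^d$ if there are no columns). For a proper subset $Z\subsetneq[d]$ let $V(Z)$ be obtained from $V$ by removing all columns $j$ having a finite entry $v_{ij}$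 with $i\in Z$ and then removing the rows in $Z$; its covector decomposition of $\mathbb R^{[d]\setminus Z}/\mathbb R\mathbf 1$ decomposes the stratum $\{p : p_i=\infty\text{ iff }i\in Z\}$. The cells of all these decompositions, over all $Z$, are the cells of the covector decomposition of $\mathbb{TP}_{\min}^{d-1}$. The graph $G$ of such a cell $C$ is the set of all $(i,j)\in[d]\times[n]$ with $v_{ij}\neq\infty$ and $C\subseteq\overline{S_i(v^{(j)})}$. "Generate a piecewise linear decomposition" means: the signed cells cover $\mathbb{TP}_{\min}^{d-1}$, and each signed cell (hence also each intersection of signed cells) is a union of cells of the covector decomposition of $\mathbb{TP}_{\min}^{d-1}$ by $V$. *)

theory Defs
  imports "HOL-Library.Extended_Real" "HOL-Library.FuncSet"
begin

text \<open>
  Vectors with coordinates indexed by a set \<open>R\<close> of row labels are functions that are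
  extensional on \<open>R\<close>, so that two vectors are equal iff they agree on \<open>R\<close>. The row labels
  are \<open>{1..d}\<close>, or \<open>{1..d} - Z\<close> for the strata at infinity. Real vectors are vectors with
  values in \<open>range ereal\<close>, which makes them literally a subset of the tropical vectors.
\<close>

type_synonym tvec = "nat \<Rightarrow> ereal"

definition T_min :: "ereal set" where
  "T_min = {x. x \<noteq> -\<infinity>}"

definition real_vecs :: "nat set \<Rightarrow> tvec set" where
  "real_vecs R = R \<rightarrow>\<^sub>E range ereal"

definition trop_vecs :: "nat set \<Rightarrow> tvec set" where
  "trop_vecs R = R \<rightarrow>\<^sub>E T_min"

definition tadd :: "nat set \<Rightarrow> tvec \<Rightarrow> tvec \<Rightarrow> tvec" where
  "tadd R x y = (\<lambda>i\<in>R. x i + y i)"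

definition trop_vecs' :: "nat set \<Rightarrow> tvec set" where
  "trop_vecs' R = trop_vecs R - {\<lambda>i\<in>R. \<infinity>}"

definition translate_rel :: "nat set \<Rightarrow> (tvec \<times> tvec) set" where
  "translate_rel R =
     {(x, y). x \<in> trop_vecs' R \<and> y \<in> trop_vecs' R \<and> (\<exists>c::real. y = tadd R (\<lambda>_. ereal c) x)}"

definition TP_min :: "nat \<Rightarrow> tvec set set" where
  "TP_min d = trop_vecs' {1..d} // translate_rel {1..d}"
  \<comment> \<open>\<open>TP_min d\<close> is the space of dimension \<open>d - 1\<close>; its points are classes modulo the
    all-ones direction.\<close>

definition mod_ones :: "nat \<Rightarrow> tvec set \<Rightarrow> tvec set set" where
  "mod_ones d A = (\<lambda>x. translate_rel {1..d} `` {x}) ` (A \<inter> trop_vecs' {1..d})"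
  \<comment> \<open>The intersection discards the vector all of whose entries are infinite.\<close>

definition supp :: "nat set \<Rightarrow> tvec \<Rightarrow> nat set" where
  "supp R u = {i \<in> R. u i \<noteq> \<infinity>}"

definition sector :: "nat set \<Rightarrow> tvec \<Rightarrow> nat \<Rightarrow> tvec set" where
  "sector R u i = {z \<in> real_vecs R. \<forall>l\<in>supp R u. z l - z i \<le> u l - u i}"
  \<comment> \<open>Meaningful, and only used, for \<open>i \<in> supp R u\<close>; then all four entries are finite.\<close>

definition inf_vec :: "nat set \<Rightarrow> nat set \<Rightarrow> tvec" where
  "inf_vec R K = (\<lambda>i\<in>R. if i \<in> K then \<infinity> else 0)"

definition inf_sets_A :: "nat set \<Rightarrow> tvec \<Rightarrow> nat \<Rightarrow> nat set set" where
  "inf_sets_A R u i = {{}} \<union> {M \<union> {i} |M. M \<subseteq> supp R u}"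

definition inf_sets_B :: "nat set \<Rightarrow> tvec \<Rightarrow> nat set set" where
  "inf_sets_B R u = {M. M \<subseteq> R - supp R u}"

definition inf_sets :: "nat set \<Rightarrow> tvec \<Rightarrow> nat \<Rightarrow> nat set set" where
  "inf_sets R u i = {A \<union> B |A B. A \<in> inf_sets_A R u i \<and> B \<in> inf_sets_B R u}"

definition closed_sector :: "nat set \<Rightarrow> tvec \<Rightarrow> nat \<Rightarrow> tvec set" where
  "closed_sector R u i =
     (if i \<in> supp R u
      then sector R u i \<union> (\<Union>K\<in>inf_sets R u i. tadd R (inf_vec R K) ` sector R u i)
      else {})"

definition column :: "nat set \<Rightarrow> (nat \<Rightarrow> nat \<Rightarrow> ereal) \<Rightarrow> nat \<Rightarrow> tvec" where
  "column R V j = (\<lambda>i\<in>R. V i j)"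

definition closed_thalf ::
  "nat \<Rightarrow> nat \<Rightarrow> (nat \<Rightarrow> nat \<Rightarrow> ereal) \<Rightarrow> (nat \<times> nat) set \<Rightarrow> tvec set set" where
  "closed_thalf d n V \<Phi> =
     TP_min d \<inter>
     (\<Inter>j\<in>{1..n}. \<Union>i\<in>{i. (i, j) \<in> \<Phi>}. mod_ones d (closed_sector {1..d} (column {1..d} V j) i))"
  \<comment> \<open>Intersecting with \<open>TP_min d\<close> matters only for \<open>n = 0\<close>.\<close>

datatype sign = Plus | Minus

definition sign_vecs :: "nat \<Rightarrow> (nat \<Rightarrow> sign) set" where
  "sign_vecs n = {1..n} \<rightarrow>\<^sub>E UNIV"

definition signed_graph ::
  "nat \<Rightarrow> nat \<Rightarrow> (nat \<times> nat) set \<Rightarrow> (nat \<Rightarrow> sign) \<Rightarrow> (nat \<times> nat) set" where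
  "signed_graph d n \<Psi> \<epsilon> =
     {(i, j) \<in> {1..d} \<times> {1..n}.
        ((i, j) \<in> \<Psi> \<and> \<epsilon> j = Plus) \<or> ((i, j) \<notin> \<Psi> \<and> \<epsilon> j = Minus)}"

definition signed_cells ::
  "nat \<Rightarrow> nat \<Rightarrow> (nat \<Rightarrow> nat \<Rightarrow> ereal) \<Rightarrow> (nat \<times> nat) set \<Rightarrow> tvec set set set" where
  "signed_cells d n V \<Psi> =
     {S. S \<noteq> {} \<and> (\<exists>\<epsilon>\<in>sign_vecs n. S = closed_thalf d n V (signed_graph d n \<Psi> \<epsilon>))}"

definition sector_complex :: "nat set \<Rightarrow> tvec \<Rightarrow> tvec set set" where
  "sector_complex R u = {(\<Inter>i\<in>I. sector R u i) |I. I \<subseteq> supp R u \<and> I \<noteq> {}}"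

text \<open>
  \<open>real_covector_cells R J V\<close> is the decomposition of the real vectors by the submatrix of
  \<open>V\<close> with rows \<open>R\<close> and columns \<open>J\<close>: the common refinement of the complexes of its columns.
  Cells are nonempty; for \<open>J = {}\<close> the only cell is the whole real space.
\<close>

definition real_covector_cells ::
  "nat set \<Rightarrow> nat set \<Rightarrow> (nat \<Rightarrow> nat \<Rightarrow> ereal) \<Rightarrow> tvec set set" where
  "real_covector_cells R J V =
     {C. C \<noteq> {} \<and>
         (\<exists>c. (\<forall>j\<in>J. c j \<in> sector_complex R (column R V j)) \<and>
              C = real_vecs R \<inter> (\<Inter>j\<in>J. c j))}"

definition kept_columns ::
  "nat \<Rightarrow> (nat \<Rightarrow> nat \<Rightarrow> ereal) \<Rightarrow> nat set \<Rightarrow> nat set" where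
  "kept_columns n V Z = {j \<in> {1..n}. \<not> (\<exists>i\<in>Z. V i j \<noteq> \<infinity>)}"

definition extend_inf :: "nat \<Rightarrow> nat set \<Rightarrow> tvec \<Rightarrow> tvec" where
  "extend_inf d Z x = (\<lambda>i\<in>{1..d}. if i \<in> Z then \<infinity> else x i)"

definition covector_cells ::
  "nat \<Rightarrow> nat \<Rightarrow> (nat \<Rightarrow> nat \<Rightarrow> ereal) \<Rightarrow> tvec set set set" where
  "covector_cells d n V =
     {mod_ones d (extend_inf d Z ` C) |Z C.
        Z \<subset> {1..d} \<and> C \<in> real_covector_cells ({1..d} - Z) (kept_columns n V Z) V}"

definition cell_graph ::
  "nat \<Rightarrow> nat \<Rightarrow> (nat \<Rightarrow> nat \<Rightarrow> ereal) \<Rightarrow> tvec set set \<Rightarrow> (nat \<times> nat) set" where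
  "cell_graph d n V C =
     {(i, j) \<in> {1..d} \<times> {1..n}.
        V i j \<noteq> \<infinity> \<and> C \<subseteq> mod_ones d (closed_sector {1..d} (column {1..d} V j) i)}"

text \<open>
  A family \<open>\<S>\<close> of subsets of \<open>X\<close> generates a piecewise linear decomposition of \<open>X\<close>,
  relative to a family \<open>\<C>\<close> of polyhedral cells: it covers \<open>X\<close>, and its members and their
  intersections are unions of cells (the empty union where an intersection is empty).
\<close>

definition generates_pl_decomposition :: "'a set set \<Rightarrow> 'a set set \<Rightarrow> 'a set \<Rightarrow> bool" where
  "generates_pl_decomposition \<S> \<C> X \<longleftrightarrow>
     \<Union>\<S> = X \<and>
     (\<forall>S\<in>\<S>. \<exists>\<D>\<subseteq>\<C>. S = \<Union>\<D>) \<and>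
     (\<forall>\<T>\<subseteq>\<S>. \<T> \<noteq> {} \<longrightarrow> (\<exists>\<D>\<subseteq>\<C>. \<Inter>\<T> = \<Union>\<D>))"

definition isolated_column_node :: "(nat \<times> nat) set \<Rightarrow> nat \<Rightarrow> bool" where
  "isolated_column_node E j \<longleftrightarrow> (\<forall>i. (i, j) \<notin> E)"

end

theory Submission
  imports Defs
begin

text \<open>
  A tropical point \<open>x\<close> lies in the closed sector \<open>i\<close> of \<open>u\<close> iff \<open>i\<close> maximizes \<open>x\<^sub>l - u\<^sub>l\<close>
  over the support of \<open>u\<close>. A maximizer always exists, so the signed cells cover the space, and
  the cell cut out by all sectors containing \<open>x\<close> lies in every signed cell containing \<open>x\<close>.
  For the graph criterion one needs that a cell covered by several sectors of a column lies in
  a single one: maximizer sets of two points of a cell intersect, and the midpoint then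
  realizes the intersection, so a point of the cell with fewest maximizers is generic.
\<close>

text \<open>The condition \<open>x l - u l \<le> x i - u i\<close>, written additively so that it makes sense when
  entries of \<open>x\<close> are infinite.\<close>

definition maximizers :: "nat set \<Rightarrow> tvec \<Rightarrow> tvec \<Rightarrow> nat set" where
  "maximizers R u x = {i \<in> supp R u. \<forall>l\<in>supp R u. x l + u i \<le> x i + u l}"

section \<open>Sectors and their closures in terms of maximizers\<close>

lemma real_vecs_subset_trop_vecs: "real_vecs R \<subseteq> trop_vecs R"
  unfolding real_vecs_def trop_vecs_def by (rule PiE_mono) (auto simp: T_min_def)

lemma real_vecs_entry: "\<lbrakk>z \<in> real_vecs R; l \<in> R\<rbrakk> \<Longrightarrow> \<exists>r. z l = ereal r"
  unfolding real_vecs_def PiE_def Pi_def by blast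

lemma trop_vecs_entry: "\<lbrakk>x \<in> trop_vecs R; l \<in> R\<rbrakk> \<Longrightarrow> x l \<noteq> -\<infinity>"
  unfolding trop_vecs_def by (auto simp: T_min_def)

lemma supp_entry: "\<lbrakk>u \<in> trop_vecs R; l \<in> supp R u\<rbrakk> \<Longrightarrow> \<exists>r. u l = ereal r"
  using trop_vecs_entry[of u R l] by (cases "u l") (auto simp: supp_def)

text \<open>All four entries involved are finite, so the subtractions rearrange to the additive
  form.\<close>

lemma mem_sector_iff:
  assumes u: "u \<in> trop_vecs R" and i: "i \<in> supp R u"
  shows "z \<in> sector R u i \<longleftrightarrow> z \<in> real_vecs R \<and> i \<in> maximizers R u z"
proof -
  have "z l - z i \<le> u l - u i \<longleftrightarrow> z l + u i \<le> z i + u l"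
    if z: "z \<in> real_vecs R" and l: "l \<in> supp R u" for l
  proof -
    have lR: "l \<in> R" "i \<in> R" using l i by (auto simp: supp_def)
    obtain a b p q where "z l = ereal a" "z i = ereal b" "u l = ereal p" "u i = ereal q"
      using real_vecs_entry[OF z lR(1)] real_vecs_entry[OF z lR(2)]
        supp_entry[OF u l] supp_entry[OF u i] by blast
    then show ?thesis by auto
  qed
  then show ?thesis using i by (auto simp: sector_def maximizers_def)
qed

text \<open>Inserting infinite entries on \<open>K\<close> keeps \<open>i\<close> maximal because
  \<open>K\<close> either contains \<open>i\<close> or misses the support. Conversely, the infinite
  entries of \<open>x\<close> form an admissible set, and finite values can be filled in without
  losing the maximality of \<open>i\<close>. The all-infinite vector is treated like any other here;
  it disappears only in the quotient.\<close>

lemma mem_closed_sector_iff: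
  assumes u: "u \<in> trop_vecs R" and fin: "finite R"
  shows "x \<in> closed_sector R u i \<longleftrightarrow> x \<in> trop_vecs R \<and> i \<in> maximizers R u x"
proof
  assume x: "x \<in> closed_sector R u i"
  then have i: "i \<in> supp R u" by (auto simp: closed_sector_def split: if_splits)
  from x i consider "x \<in> sector R u i"
    | K z where "K \<in> inf_sets R u i" "z \<in> sector R u i" "x = tadd R (inf_vec R K) z"
    by (auto simp: closed_sector_def)
  then show "x \<in> trop_vecs R \<and> i \<in> maximizers R u x"
  proof cases
    case 1
    then show ?thesis using mem_sector_iff[OF u i] real_vecs_subset_trop_vecs by blast
  next
    case 2
    from 2(2) have z: "z \<in> real_vecs R" and max: "i \<in> maximizers R u z"
      using mem_sector_iff[OF u i] by auto
    have x: "x l = (if l \<in> K then \<infinity> else z l)" if "l \<in> R" for l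
      using real_vecs_entry[OF z that] that by (auto simp: 2(3) tadd_def inf_vec_def)
    have "x l \<in> T_min" if "l \<in> R" for l
      using real_vecs_entry[OF z that] x[OF that] by (auto simp: T_min_def)
    then have "x \<in> trop_vecs R" by (auto simp: 2(3) trop_vecs_def tadd_def)
    moreover have "x l + u i \<le> x i + u l" if l: "l \<in> supp R u" for l
    \<comment> \<open>With \<open>i\<close> in \<open>K\<close> the right-hand side is infinite.
      Otherwise the contribution from \<open>inf_sets_A\<close> must be empty, so \<open>K\<close>
      misses the support and the inequality is the one for \<open>z\<close>.\<close>
    proof (cases "i \<in> K")
      case True
      then show ?thesis using x[of i] i trop_vecs_entry[OF u] l by (auto simp: supp_def)
    next
      case False
      then have "K \<subseteq> R - supp R u"
        using 2(1) by (auto simp: inf_sets_def inf_sets_A_def inf_sets_B_def)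
      then show ?thesis
        using False l i max x[of i] x[of l] by (auto simp: supp_def maximizers_def)
    qed
    ultimately show ?thesis using i by (auto simp: maximizers_def)
  qed
next
  assume asm: "x \<in> trop_vecs R \<and> i \<in> maximizers R u x"
  then have x: "x \<in> trop_vecs R" and i: "i \<in> supp R u"
    and max: "\<And>l. l \<in> supp R u \<Longrightarrow> x l + u i \<le> x i + u l"
    by (auto simp: maximizers_def)
  have iR: "i \<in> R" using i by (auto simp: supp_def)
  define K where "K = {l \<in> R. x l = \<infinity>}"
  \<comment> \<open>Entries of \<open>u\<close> on the support are finite, so an infinite
    \<open>x l\<close> there forces \<open>x i\<close> to be infinite.\<close>
  have K_i: "i \<in> K" if "l \<in> K" "l \<in> supp R u" for l
    using max[OF that(2)] that(1) supp_entry[OF u i] supp_entry[OF u that(2)] iR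
    by (cases "x i") (auto simp: K_def)
  \<comment> \<open>\<open>real_of_ereal\<close> turns infinite entries into 0; the bound is applied
    only where both entries are finite.\<close>
  have "bdd_above ((\<lambda>l. real_of_ereal (x l) - real_of_ereal (u l)) ` R)"
    using fin by (intro bdd_above_finite) auto
  then obtain c where c: "\<And>l. l \<in> R \<Longrightarrow> real_of_ereal (x l) - real_of_ereal (u l) \<le> c"
    by (auto simp: bdd_above_def)
  \<comment> \<open>Replacing the infinite entries of \<open>x\<close> on the support by those of \<open>u + c\<close> keeps \<open>i\<close> maximal
    once \<open>c\<close> exceeds all finite differences.\<close>
  define z where "z = (\<lambda>l\<in>R. if l \<in> K then (if l \<in> supp R u then u l + ereal c else 0) else x l)"
  have z_real: "z \<in> real_vecs R"
    unfolding real_vecs_def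
  proof (rule PiE_I)
    fix l assume l: "l \<in> R"
    then show "z l \<in> range ereal"
      using trop_vecs_entry[OF x l] supp_entry[OF u, of l]
      by (cases "x l") (auto simp: z_def K_def zero_ereal_def)
  qed (simp add: z_def)
  have "z l + u i \<le> z i + u l" if l: "l \<in> supp R u" for l
  proof -
    have lR: "l \<in> R" using l by (auto simp: supp_def)
    obtain p q where pq: "u l = ereal p" "u i = ereal q"
      using supp_entry[OF u l] supp_entry[OF u i] by blast
    show ?thesis
    proof (cases "i \<in> K")
      case False
      then have "l \<notin> K" using K_i l by blast
      then show ?thesis using False max[OF l] lR iR by (simp add: z_def)
    next
      case True
      then have zi: "z i = ereal (q + c)" using i iR pq by (simp add: z_def)
      show ?thesis
      proof (cases "l \<in> K")
        case True
        then show ?thesis using zi pq l lR by (simp add: z_def)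
      next
        case False
        then obtain a where "x l = ereal a"
          using trop_vecs_entry[OF x lR] lR by (cases "x l") (auto simp: K_def)
        then show ?thesis using zi pq c[OF lR] lR False by (simp add: z_def)
      qed
    qed
  qed
  then have "z \<in> sector R u i" using i z_real mem_sector_iff[OF u i] by (auto simp: maximizers_def)
  moreover have "K \<in> inf_sets R u i"
  proof -
    \<comment> \<open>By \<open>K_i\<close>, the part of \<open>K\<close> inside the support is
      empty or contains \<open>i\<close>, which are the two shapes in
      \<open>inf_sets_A\<close>.\<close>
    have "K \<inter> supp R u \<in> inf_sets_A R u i"
    proof (cases "i \<in> K")
      case True
      then have "K \<inter> supp R u = (K \<inter> supp R u) \<union> {i}" using i by blast
      then show ?thesis unfolding inf_sets_A_def by blast
    next
      case False
      then have "K \<inter> supp R u = {}" using K_i by blast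
      then show ?thesis by (simp add: inf_sets_A_def)
    qed
    moreover have "K - supp R u \<in> inf_sets_B R u"
      by (auto simp: inf_sets_B_def K_def)
    moreover have "K = (K \<inter> supp R u) \<union> (K - supp R u)" by blast
    ultimately show ?thesis unfolding inf_sets_def by blast
  qed
  moreover have "x = tadd R (inf_vec R K) z"
  proof
    fix l
    show "x l = tadd R (inf_vec R K) z l"
    proof (cases "l \<in> R")
      case True
      then show ?thesis using real_vecs_entry[OF z_real True]
        by (auto simp: tadd_def inf_vec_def K_def z_def)
    next
      case False
      then show ?thesis using x by (auto simp: tadd_def trop_vecs_def)
    qed
  qed
  ultimately show "x \<in> closed_sector R u i" using i by (auto simp: closed_sector_def)
qed

text \<open>A maximum over a finite nonempty index set is attained. Since \<open>u l\<close> is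
  finite on the support, the differences are meaningful even for infinite
  \<open>x l\<close>.\<close>

lemma maximizers_nonempty:
  assumes u: "u \<in> trop_vecs R" and fin: "finite R" and ne: "supp R u \<noteq> {}"
    and x: "x \<in> trop_vecs R"
  shows "maximizers R u x \<noteq> {}"
proof -
  let ?D = "(\<lambda>l. x l - u l) ` supp R u"
  have D: "finite ?D" "?D \<noteq> {}" using fin ne by (auto simp: supp_def)
  then obtain i where i: "i \<in> supp R u" and Max: "Max ?D = x i - u i"
    using Max_in[OF D] by blast
  have max: "x l - u l \<le> x i - u i" if "l \<in> supp R u" for l
    using Max_ge[OF D(1)] that unfolding Max[symmetric] by blast
  have "x l + u i \<le> x i + u l" if l: "l \<in> supp R u" for l
  proof -
    obtain p q where "u l = ereal p" "u i = ereal q"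
      using supp_entry[OF u l] supp_entry[OF u i] by blast
    then show ?thesis using max[OF l] by (cases "x l"; cases "x i") auto
  qed
  then show ?thesis using i by (auto simp: maximizers_def)
qed

section \<open>Midpoints and generic points\<close>

definition midpoint_vec :: "nat set \<Rightarrow> tvec \<Rightarrow> tvec \<Rightarrow> tvec" where
  "midpoint_vec R y z = (\<lambda>l\<in>R. (y l + z l) / 2)"

lemma midpoint_vec_real:
  assumes "y \<in> real_vecs R" "z \<in> real_vecs R"
  shows "midpoint_vec R y z \<in> real_vecs R"
  unfolding real_vecs_def
proof (rule PiE_I)
  fix l assume l: "l \<in> R"
  obtain a b where "y l = ereal a" "z l = ereal b"
    using real_vecs_entry[OF assms(1) l] real_vecs_entry[OF assms(2) l] by blast
  then have "midpoint_vec R y z l = ereal ((a + b) / 2)" using l by (simp add: midpoint_vec_def)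
  then show "midpoint_vec R y z l \<in> range ereal" by blast
qed (simp add: midpoint_vec_def)

text \<open>A common maximizer \<open>k\<close> attains both maxima at once, so the maximum of the
  summed differences is the sum of the two maxima, and it is attained exactly where both
  are.\<close>

lemma maximizers_midpoint_vec:
  assumes u: "u \<in> trop_vecs R" and y: "y \<in> real_vecs R" and z: "z \<in> real_vecs R"
    and common: "maximizers R u y \<inter> maximizers R u z \<noteq> {}"
  shows "maximizers R u (midpoint_vec R y z) = maximizers R u y \<inter> maximizers R u z"
proof -
  obtain k where k: "k \<in> maximizers R u y" "k \<in> maximizers R u z" using common by blast
  \<comment> \<open>On the support of \<open>u\<close> everything is finite, so the differences may
    be taken as reals, where averaging is linear.\<close>
  define r where "r = (\<lambda>x l. real_of_ereal (x l) - real_of_ereal (u l))"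
  have iff: "i \<in> maximizers R u x \<longleftrightarrow> i \<in> supp R u \<and> (\<forall>l\<in>supp R u. r x l \<le> r x i)"
    if x: "x \<in> real_vecs R" for x i
  proof -
    have "x l + u i \<le> x i + u l \<longleftrightarrow> r x l \<le> r x i" if l: "l \<in> supp R u" and i: "i \<in> supp R u" for l
    proof -
      have "l \<in> R" "i \<in> R" using l i by (auto simp: supp_def)
      then obtain a b p q where "x l = ereal a" "x i = ereal b" "u l = ereal p" "u i = ereal q"
        using real_vecs_entry[OF x] supp_entry[OF u l] supp_entry[OF u i] by metis
      then show ?thesis by (auto simp: r_def)
    qed
    then show ?thesis by (auto simp: maximizers_def)
  qed
  have mid: "r (midpoint_vec R y z) l = (r y l + r z l) / 2" if l: "l \<in> supp R u" for l
  proof -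
    have "l \<in> R" using l by (auto simp: supp_def)
    then obtain a b where "y l = ereal a" "z l = ereal b"
      using real_vecs_entry[OF y] real_vecs_entry[OF z] by metis
    then show ?thesis using \<open>l \<in> R\<close> by (simp add: r_def midpoint_vec_def field_simps)
  qed
  have k': "k \<in> supp R u" "\<And>l. l \<in> supp R u \<Longrightarrow> r y l \<le> r y k"
    "\<And>l. l \<in> supp R u \<Longrightarrow> r z l \<le> r z k"
    using k iff[OF y] iff[OF z] by auto
  have char: "(\<forall>l\<in>supp R u. r y l + r z l \<le> r y i + r z i) \<longleftrightarrow>
      (\<forall>l\<in>supp R u. r y l \<le> r y i) \<and> (\<forall>l\<in>supp R u. r z l \<le> r z i)"
    if i: "i \<in> supp R u" for i
  proof
    assume "\<forall>l\<in>supp R u. r y l + r z l \<le> r y i + r z i"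
    then have "r y k + r z k \<le> r y i + r z i" using k'(1) by blast
    \<comment> \<open>Neither summand at \<open>i\<close> exceeds its value at \<open>k\<close>; as
      the sum is no smaller, both are equal.\<close>
    then have "r y i = r y k" "r z i = r z k" using k'(2,3)[OF i] by linarith+
    then show "(\<forall>l\<in>supp R u. r y l \<le> r y i) \<and> (\<forall>l\<in>supp R u. r z l \<le> r z i)"
      using k' by simp
  qed (auto intro: add_mono)
  have "i \<in> maximizers R u (midpoint_vec R y z) \<longleftrightarrow>
      i \<in> supp R u \<and> (\<forall>l\<in>supp R u. r y l + r z l \<le> r y i + r z i)" for i
    by (auto simp: iff[OF midpoint_vec_real[OF y z]] mid)
  then show ?thesis using char by (auto simp: iff[OF y] iff[OF z])
qed

text \<open>Choose \<open>x\<close> with the fewest maximizers. Its midpoint with any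
  \<open>y\<close> stays in \<open>S\<close> and has the intersection of the two maximizer sets, so
  minimality makes that intersection all of the set of \<open>x\<close>. The shared \<open>k\<close>
  provides the nonempty intersection that the midpoint formula requires.\<close>

lemma ex_generic_point:
  assumes u: "u \<in> trop_vecs R" and fin: "finite R"
    and S: "S \<subseteq> real_vecs R" "S \<noteq> {}"
    and common: "\<And>y. y \<in> S \<Longrightarrow> k \<in> maximizers R u y"
    and mid: "\<And>y z. \<lbrakk>y \<in> S; z \<in> S\<rbrakk> \<Longrightarrow> midpoint_vec R y z \<in> S"
  shows "\<exists>x\<in>S. \<forall>y\<in>S. maximizers R u x \<subseteq> maximizers R u y"
proof -
  obtain x where x: "x \<in> S"
    and min: "\<And>y. y \<in> S \<Longrightarrow> card (maximizers R u x) \<le> card (maximizers R u y)"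
    using S(2) ex_has_least_nat[of "\<lambda>x. x \<in> S" _ "\<lambda>x. card (maximizers R u x)"] by blast
  have "maximizers R u x \<subseteq> maximizers R u y" if y: "y \<in> S" for y
  proof -
    have eq: "maximizers R u (midpoint_vec R x y) = maximizers R u x \<inter> maximizers R u y"
      using x y S(1) common by (intro maximizers_midpoint_vec[OF u]) blast+
    have fin': "finite (maximizers R u x)" using fin by (simp add: maximizers_def supp_def)
    have "maximizers R u x \<inter> maximizers R u y = maximizers R u x"
      using min[OF mid[OF x y]] fin' unfolding eq by (intro card_seteq) auto
    then show ?thesis by blast
  qed
  then show ?thesis using x by blast
qed

section \<open>Cells of the real covector decomposition\<close>

lemma column_trop_vecs:
  "\<lbrakk>R \<subseteq> D; \<forall>i\<in>D. V i j \<in> T_min\<rbrakk> \<Longrightarrow> column R V j \<in> trop_vecs R"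
  by (auto simp: column_def trop_vecs_def)

lemma supp_column: "supp R (column R V j) = {i \<in> R. V i j \<noteq> \<infinity>}"
  by (auto simp: supp_def column_def)

lemma mem_maximizers_column_iff:
  "i \<in> maximizers R (column R V j) x \<longleftrightarrow>
    i \<in> R \<and> V i j \<noteq> \<infinity> \<and> (\<forall>l\<in>R. V l j \<noteq> \<infinity> \<longrightarrow> x l + V i j \<le> x i + V l j)"
  unfolding maximizers_def supp_column by (auto simp: column_def)

lemma mem_sector_complexE:
  assumes "u \<in> trop_vecs R" "c \<in> sector_complex R u"
  obtains I where "I \<subseteq> supp R u" "I \<noteq> {}" "c = {z \<in> real_vecs R. I \<subseteq> maximizers R u z}"
proof -
  from assms(2) obtain I where I: "I \<subseteq> supp R u" "I \<noteq> {}" "c = (\<Inter>i\<in>I. sector R u i)"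
    by (auto simp: sector_complex_def)
  have "c = {z \<in> real_vecs R. I \<subseteq> maximizers R u z}"
    unfolding I(3) using mem_sector_iff[OF assms(1)] I(1,2) by blast
  then show thesis using that I by blast
qed

text \<open>Applied with \<open>I\<close> the maximizer set of a given point, this yields the
  smallest cell of the complex around that point.\<close>

lemma maximal_set_in_sector_complex:
  assumes "u \<in> trop_vecs R" "I \<subseteq> supp R u" "I \<noteq> {}"
  shows "{z \<in> real_vecs R. I \<subseteq> maximizers R u z} \<in> sector_complex R u"
proof -
  have "{z \<in> real_vecs R. I \<subseteq> maximizers R u z} = (\<Inter>i\<in>I. sector R u i)"
    using mem_sector_iff[OF assms(1)] assms(2,3) by blast
  then show ?thesis using assms(2,3) by (auto simp: sector_complex_def)
qed

text \<open>The cell prescribes a nonempty set \<open>I j\<close> of maximizers in every column.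
  Intersecting maximizer sets preserves these conditions, so the cell is closed under midpoints, and
  any element of \<open>I j\<close> is a common maximizer for column \<open>j\<close>.\<close>

lemma real_covector_cell_generic_point:
  assumes C: "C \<in> real_covector_cells R J V" and fin: "finite R" and j: "j \<in> J"
    and V: "\<And>j. j \<in> J \<Longrightarrow> column R V j \<in> trop_vecs R"
  shows "\<exists>x\<in>C. \<forall>y\<in>C. maximizers R (column R V j) x \<subseteq> maximizers R (column R V j) y"
proof -
  from C obtain c where C_ne: "C \<noteq> {}" and c: "\<And>j. j \<in> J \<Longrightarrow> c j \<in> sector_complex R (column R V j)"
    and C_eq: "C = real_vecs R \<inter> (\<Inter>j\<in>J. c j)"
    by (auto simp: real_covector_cells_def)
  have "\<exists>I. I \<noteq> {} \<and> c j = {z \<in> real_vecs R. I \<subseteq> maximizers R (column R V j) z}"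
    if "j \<in> J" for j
    using mem_sector_complexE[OF V[OF that] c[OF that]] by metis
  then obtain I where I: "\<And>j. j \<in> J \<Longrightarrow> I j \<noteq> {}"
    "\<And>j. j \<in> J \<Longrightarrow> c j = {z \<in> real_vecs R. I j \<subseteq> maximizers R (column R V j) z}"
    by metis
  have C_iff: "z \<in> C \<longleftrightarrow> z \<in> real_vecs R \<and> (\<forall>j\<in>J. I j \<subseteq> maximizers R (column R V j) z)" for z
    using I(2) by (auto simp: C_eq)
  obtain k where k: "k \<in> I j" using I(1)[OF j] by blast
  show ?thesis
  proof (rule ex_generic_point[OF V[OF j] fin _ C_ne])
    show "C \<subseteq> real_vecs R" using C_eq by blast
    show "k \<in> maximizers R (column R V j) y" if "y \<in> C" for y
      using that C_iff k j by blast
    show "midpoint_vec R y z \<in> C" if yz: "y \<in> C" "z \<in> C" for y z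
    proof -
      have real: "y \<in> real_vecs R" "z \<in> real_vecs R" using yz C_iff by auto
      have "I i \<subseteq> maximizers R (column R V i) (midpoint_vec R y z)" if i: "i \<in> J" for i
      proof -
        have "I i \<subseteq> maximizers R (column R V i) y \<inter> maximizers R (column R V i) z"
          using yz C_iff i by blast
        then show ?thesis using maximizers_midpoint_vec[OF V[OF i] real] I(1)[OF i] by blast
      qed
      then show ?thesis using C_iff midpoint_vec_real[OF real] by blast
    qed
  qed
qed

section \<open>Maximizers on the strata at infinity\<close>

text \<open>The support of a kept column avoids \<open>Z\<close>, so the infinite coordinates are
  invisible to it. A removed column attains the value infinity exactly in its finite rows inside
  \<open>Z\<close>, independently of \<open>y\<close>.\<close>

lemma maximizers_extend_inf:
  assumes V: "\<forall>i\<in>{1..d}. \<forall>j\<in>{1..n}. V i j \<in> T_min" and j: "j \<in> {1..n}"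
    and Z: "Z \<subseteq> {1..d}" and y: "y \<in> real_vecs ({1..d} - Z)"
  shows "maximizers {1..d} (column {1..d} V j) (extend_inf d Z y) =
    (if j \<in> kept_columns n V Z then maximizers ({1..d} - Z) (column ({1..d} - Z) V j) y
     else {i \<in> Z. V i j \<noteq> \<infinity>})"
proof (cases "j \<in> kept_columns n V Z")
  case True
  have supp: "supp {1..d} (column {1..d} V j) = supp ({1..d} - Z) (column ({1..d} - Z) V j)"
    using True by (auto simp: kept_columns_def supp_column)
  have "extend_inf d Z y l = y l \<and> column {1..d} V j l = column ({1..d} - Z) V j l"
    if "l \<in> supp ({1..d} - Z) (column ({1..d} - Z) V j)" for l
    using that by (simp add: supp_def column_def extend_inf_def)
  then show ?thesis using True unfolding maximizers_def supp by auto
next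
  case False
  then obtain k where k: "k \<in> Z" "V k j \<noteq> \<infinity>" using j by (auto simp: kept_columns_def)
  have minf: "V i j \<noteq> -\<infinity>" if "i \<in> {1..d}" for i using V j that by (auto simp: T_min_def)
  have "i \<in> maximizers {1..d} (column {1..d} V j) (extend_inf d Z y) \<longleftrightarrow> i \<in> Z \<and> V i j \<noteq> \<infinity>" for i
  proof
    assume i: "i \<in> maximizers {1..d} (column {1..d} V j) (extend_inf d Z y)"
    then have i': "i \<in> {1..d}" "V i j \<noteq> \<infinity>" unfolding mem_maximizers_column_iff by blast+
    \<comment> \<open>Comparison with the row \<open>k\<close> in \<open>Z\<close> makes the left
      side infinite; as \<open>V k j\<close> is finite, coordinate \<open>i\<close> of the point
      must be infinite.\<close>
    have "extend_inf d Z y k + V i j \<le> extend_inf d Z y i + V k j"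
      using i k Z unfolding mem_maximizers_column_iff by blast
    then have "\<infinity> \<le> extend_inf d Z y i + V k j"
      using k Z minf[OF i'(1)] by (auto simp: extend_inf_def)
    then have "i \<in> Z"
      using k i' real_vecs_entry[OF y, of i] by (auto simp: extend_inf_def split: if_splits)
    then show "i \<in> Z \<and> V i j \<noteq> \<infinity>" using i' by simp
  next
    assume i: "i \<in> Z \<and> V i j \<noteq> \<infinity>"
    then show "i \<in> maximizers {1..d} (column {1..d} V j) (extend_inf d Z y)"
      using Z minf by (auto simp: mem_maximizers_column_iff extend_inf_def)
  qed
  then show ?thesis using False by auto
qed

section \<open>Passage to the quotient by the all-ones direction\<close>

lemma tadd_const_translate:
  "tadd R (\<lambda>_. ereal c) (tadd R (\<lambda>_. ereal b) x) = tadd R (\<lambda>_. ereal (c + b)) x"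
  by (auto simp: tadd_def fun_eq_iff add.assoc simp flip: plus_ereal.simps(1))

lemma tadd_zero: "x \<in> trop_vecs R \<Longrightarrow> tadd R (\<lambda>_. ereal 0) x = x"
  by (auto simp: tadd_def trop_vecs_def fun_eq_iff PiE_def extensional_def)

lemma equiv_translate_rel: "equiv (trop_vecs' R) (translate_rel R)"
proof (rule equivI)
  show "translate_rel R \<subseteq> trop_vecs' R \<times> trop_vecs' R" by (auto simp: translate_rel_def)
  show "refl_on (trop_vecs' R) (translate_rel R)"
  proof (rule refl_onI)
    fix x assume "x \<in> trop_vecs' R"
    then show "(x, x) \<in> translate_rel R"
      using tadd_zero[of x R] by (auto simp: translate_rel_def trop_vecs'_def intro: exI[of _ "0::real"])
  qed
  show "sym (translate_rel R)"
  proof (rule symI)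
    fix x y assume "(x, y) \<in> translate_rel R"
    then obtain c where x: "x \<in> trop_vecs' R" "y \<in> trop_vecs' R" "y = tadd R (\<lambda>_. ereal c) x"
      by (auto simp: translate_rel_def)
    then have "x = tadd R (\<lambda>_. ereal (- c)) y"
      using tadd_zero[of x R] by (auto simp: tadd_const_translate trop_vecs'_def simp del: ereal_eq_0)
    then show "(y, x) \<in> translate_rel R" using x by (auto simp: translate_rel_def)
  qed
  show "trans (translate_rel R)"
    by (rule transI) (auto simp: translate_rel_def tadd_const_translate)
qed

text \<open>Makes maximizer sets well defined on projective points: a real constant cancels from
  both sides, even when other entries are infinite.\<close>

lemma maximizers_translate:
  "maximizers R u (tadd R (\<lambda>_. ereal c) x) = maximizers R u x"
proof -
  have "ereal c + a + b \<le> ereal c + a' + b' \<longleftrightarrow> a + b \<le> a' + b'" for a b a' b' :: ereal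
    by (cases a; cases b; cases a'; cases b') auto
  then show ?thesis by (auto simp: maximizers_def supp_def tadd_def)
qed

abbreviation point :: "nat \<Rightarrow> tvec \<Rightarrow> tvec set" where
  "point d x \<equiv> translate_rel {1..d} `` {x}"

lemma TP_min_eq: "TP_min d = point d ` trop_vecs' {1..d}"
  by (auto simp: TP_min_def quotient_def)

text \<open>Some representative of the class lies in the closed sector; translation invariance
  carries its maximizers over to the representative \<open>x\<close>.\<close>

lemma point_in_mod_ones_closed_sector_iff:
  assumes u: "u \<in> trop_vecs {1..d}" and x: "x \<in> trop_vecs' {1..d}"
  shows "point d x \<in> mod_ones d (closed_sector {1..d} u i) \<longleftrightarrow> i \<in> maximizers {1..d} u x"
proof
  assume "point d x \<in> mod_ones d (closed_sector {1..d} u i)"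
  then obtain y where y: "y \<in> closed_sector {1..d} u i" "y \<in> trop_vecs' {1..d}" "point d x = point d y"
    by (auto simp: mod_ones_def)
  then have "(x, y) \<in> translate_rel {1..d}"
    using eq_equiv_class[OF _ equiv_translate_rel] by blast
  then obtain c where "y = tadd {1..d} (\<lambda>_. ereal c) x" by (auto simp: translate_rel_def)
  then show "i \<in> maximizers {1..d} u x"
    using y(1) mem_closed_sector_iff[OF u] maximizers_translate by auto
next
  assume "i \<in> maximizers {1..d} u x"
  then show "point d x \<in> mod_ones d (closed_sector {1..d} u i)"
    using x mem_closed_sector_iff[OF u] by (auto simp: mod_ones_def trop_vecs'_def)
qed

section \<open>Covector cells as sets of projective points\<close>

lemma extend_inf_trop_vecs':
  assumes Z: "Z \<subset> {1..d}" and y: "y \<in> real_vecs ({1..d} - Z)"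
  shows "extend_inf d Z y \<in> trop_vecs' {1..d}"
proof -
  have "extend_inf d Z y l \<in> T_min" if "l \<in> {1..d}" for l
    using real_vecs_entry[OF y, of l] that by (auto simp: extend_inf_def T_min_def)
  then have "extend_inf d Z y \<in> trop_vecs {1..d}" by (auto simp: trop_vecs_def extend_inf_def)
  moreover obtain k where k: "k \<in> {1..d} - Z" using Z by blast
  have "extend_inf d Z y k \<noteq> \<infinity>"
    using real_vecs_entry[OF y k] k by (auto simp: extend_inf_def)
  then have "extend_inf d Z y \<noteq> (\<lambda>i\<in>{1..d}. \<infinity>)" using k by auto
  ultimately show ?thesis by (simp add: trop_vecs'_def)
qed

lemma mod_ones_extend_inf:
  assumes "Z \<subset> {1..d}" "C \<subseteq> real_vecs ({1..d} - Z)"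
  shows "mod_ones d (extend_inf d Z ` C) = (\<lambda>y. point d (extend_inf d Z y)) ` C"
  using extend_inf_trop_vecs'[OF assms(1)] assms(2) by (auto simp: mod_ones_def image_image)

lemma real_covector_cell_real: "C \<in> real_covector_cells R J V \<Longrightarrow> C \<subseteq> real_vecs R"
  by (auto simp: real_covector_cells_def)

lemma covector_cellE:
  assumes "C \<in> covector_cells d n V"
  obtains Z C\<^sub>0 where "Z \<subset> {1..d}" "C\<^sub>0 \<in> real_covector_cells ({1..d} - Z) (kept_columns n V Z) V"
    "C\<^sub>0 \<subseteq> real_vecs ({1..d} - Z)" "C = (\<lambda>y. point d (extend_inf d Z y)) ` C\<^sub>0"
proof -
  from assms obtain Z C\<^sub>0 where Z: "Z \<subset> {1..d}"
    and C: "C\<^sub>0 \<in> real_covector_cells ({1..d} - Z) (kept_columns n V Z) V"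
      "C = mod_ones d (extend_inf d Z ` C\<^sub>0)"
    by (auto simp: covector_cells_def)
  then show thesis
    using that mod_ones_extend_inf[OF Z] real_covector_cell_real[OF C(1)] by metis
qed

section \<open>The graph criterion\<close>

context
  fixes d n :: nat and V :: "nat \<Rightarrow> nat \<Rightarrow> ereal"
  assumes entries: "\<forall>i\<in>{1..d}. \<forall>j\<in>{1..n}. V i j \<in> T_min"
    and columns: "\<forall>j\<in>{1..n}. \<exists>i\<in>{1..d}. V i j \<noteq> \<infinity>"
begin

abbreviation col_maximizers :: "nat \<Rightarrow> tvec \<Rightarrow> nat set" where
  "col_maximizers j x \<equiv> maximizers {1..d} (column {1..d} V j) x"

lemma point_in_closed_thalf_iff:
  assumes x: "x \<in> trop_vecs' {1..d}"
  shows "point d x \<in> closed_thalf d n V \<Phi> \<longleftrightarrow>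
    (\<forall>j\<in>{1..n}. \<exists>i\<in>col_maximizers j x. (i, j) \<in> \<Phi>)"
proof -
  have "column {1..d} V j \<in> trop_vecs {1..d}" if "j \<in> {1..n}" for j
    using column_trop_vecs[of "{1..d}" "{1..d}"] entries that by blast
  then show ?thesis
    using point_in_mod_ones_closed_sector_iff[OF _ x] x
    by (auto simp: closed_thalf_def TP_min_eq)
qed

text \<open>Any sector of column \<open>j\<close> containing the point \<open>x\<close> found here
  contains the whole cell.\<close>

lemma covector_cell_generic_point:
  assumes C: "C \<in> covector_cells d n V" and j: "j \<in> {1..n}"
  shows "\<exists>x\<in>trop_vecs' {1..d}. point d x \<in> C \<and>
    (\<forall>y\<in>trop_vecs' {1..d}. point d y \<in> C \<longrightarrow> col_maximizers j x \<subseteq> col_maximizers j y)"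
proof -
  obtain Z C\<^sub>0 where Z: "Z \<subset> {1..d}"
    and C\<^sub>0: "C\<^sub>0 \<in> real_covector_cells ({1..d} - Z) (kept_columns n V Z) V"
    and real: "C\<^sub>0 \<subseteq> real_vecs ({1..d} - Z)"
    and C_eq: "C = (\<lambda>y. point d (extend_inf d Z y)) ` C\<^sub>0"
    using covector_cellE[OF C] by blast
  let ?R = "{1..d} - Z"
  have max: "col_maximizers j (extend_inf d Z y) =
    (if j \<in> kept_columns n V Z then maximizers ?R (column ?R V j) y else {i \<in> Z. V i j \<noteq> \<infinity>})"
    if "y \<in> C\<^sub>0" for y
    using maximizers_extend_inf[OF entries j] Z real that by blast
  have "\<exists>x\<in>C\<^sub>0. \<forall>y\<in>C\<^sub>0. col_maximizers j (extend_inf d Z x) \<subseteq> col_maximizers j (extend_inf d Z y)"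
  proof (cases "j \<in> kept_columns n V Z")
    case True
    have "column ?R V i \<in> trop_vecs ?R" if "i \<in> kept_columns n V Z" for i
      using column_trop_vecs[of ?R "{1..d}"] entries that by (auto simp: kept_columns_def)
    then show ?thesis
      using real_covector_cell_generic_point[OF C\<^sub>0 _ True] max True by simp
  next
    \<comment> \<open>For a removed column the maximizer set is constant on the stratum, so every
      point of the cell is generic.\<close>
    case False
    then show ?thesis using max C\<^sub>0 by (auto simp: real_covector_cells_def)
  qed
  then obtain x where x: "x \<in> C\<^sub>0"
    "\<And>y. y \<in> C\<^sub>0 \<Longrightarrow> col_maximizers j (extend_inf d Z x) \<subseteq> col_maximizers j (extend_inf d Z y)"
    by blast
  have "col_maximizers j (extend_inf d Z x) \<subseteq> col_maximizers j y"
    if y: "y \<in> trop_vecs' {1..d}" "point d y \<in> C" for y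
  proof -
    obtain y' where y': "y' \<in> C\<^sub>0" "point d y = point d (extend_inf d Z y')"
      using y C_eq by blast
    \<comment> \<open>The class of \<open>y\<close> also has a representative coming from the
      stratum, and both have the same maximizers.\<close>
    then have "(y, extend_inf d Z y') \<in> translate_rel {1..d}"
      using eq_equiv_class[OF _ equiv_translate_rel] extend_inf_trop_vecs'[OF Z] real by blast
    then have "col_maximizers j (extend_inf d Z y') = col_maximizers j y"
      by (auto simp: translate_rel_def maximizers_translate)
    then show ?thesis using x(2)[OF y'(1)] by simp
  qed
  then show ?thesis using x(1) extend_inf_trop_vecs'[OF Z] real C_eq by blast
qed

lemma covector_cell_subset_TP_min:
  assumes "C \<in> covector_cells d n V"
  shows "C \<subseteq> TP_min d"
proof -
  obtain Z C\<^sub>0 where "Z \<subset> {1..d}" "C\<^sub>0 \<subseteq> real_vecs ({1..d} - Z)"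
    "C = (\<lambda>y. point d (extend_inf d Z y)) ` C\<^sub>0"
    using covector_cellE[OF assms] by metis
  then show ?thesis unfolding TP_min_eq using extend_inf_trop_vecs' by blast
qed

text \<open>Left to right, a sector allowed by \<open>\<Phi>\<close> at the generic point of column
  \<open>j\<close> contains the entire cell and so gives an arc of the graph at \<open>j\<close>.
  Right to left, such an arc names a single allowed sector covering the cell.\<close>

lemma covector_cell_subset_closed_thalf_iff:
  assumes C: "C \<in> covector_cells d n V" and \<Phi>: "\<Phi> \<subseteq> {1..d} \<times> {1..n}"
  shows "C \<subseteq> closed_thalf d n V \<Phi> \<longleftrightarrow>
    \<not> (\<exists>j\<in>{1..n}. isolated_column_node (\<Phi> \<inter> cell_graph d n V C) j)"
proof
  assume sub: "C \<subseteq> closed_thalf d n V \<Phi>"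
  have "\<exists>i. (i, j) \<in> \<Phi> \<inter> cell_graph d n V C" if j: "j \<in> {1..n}" for j
  proof -
    obtain x where x: "x \<in> trop_vecs' {1..d}" "point d x \<in> C"
      "\<And>y. \<lbrakk>y \<in> trop_vecs' {1..d}; point d y \<in> C\<rbrakk> \<Longrightarrow> col_maximizers j x \<subseteq> col_maximizers j y"
      using covector_cell_generic_point[OF C j] by blast
    obtain i where i: "i \<in> col_maximizers j x" "(i, j) \<in> \<Phi>"
      using point_in_closed_thalf_iff[OF x(1)] sub x(2) j by blast
    have u: "column {1..d} V j \<in> trop_vecs {1..d}"
      using column_trop_vecs[of "{1..d}" "{1..d}"] entries j by blast
    have "C \<subseteq> mod_ones d (closed_sector {1..d} (column {1..d} V j) i)"
    proof
      fix p assume p: "p \<in> C"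
      then obtain y where y: "y \<in> trop_vecs' {1..d}" "p = point d y"
        using covector_cell_subset_TP_min[OF C] by (auto simp: TP_min_eq)
      then show "p \<in> mod_ones d (closed_sector {1..d} (column {1..d} V j) i)"
        using point_in_mod_ones_closed_sector_iff[OF u y(1)] x(3)[OF y(1)] p i(1) by blast
    qed
    moreover have "V i j \<noteq> \<infinity>" using i(1) by (auto simp: maximizers_def supp_column)
    ultimately show ?thesis using i(2) \<Phi> unfolding cell_graph_def by blast
  qed
  then show "\<not> (\<exists>j\<in>{1..n}. isolated_column_node (\<Phi> \<inter> cell_graph d n V C) j)"
    by (auto simp: isolated_column_node_def)
next
  assume "\<not> (\<exists>j\<in>{1..n}. isolated_column_node (\<Phi> \<inter> cell_graph d n V C) j)"
  then show "C \<subseteq> closed_thalf d n V \<Phi>"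
    using covector_cell_subset_TP_min[OF C]
    unfolding isolated_column_node_def closed_thalf_def cell_graph_def by blast
qed

section \<open>Signed cells cover the space and are unions of covector cells\<close>

text \<open>Membership in \<open>closed_thalf\<close> is preserved when maximizer sets grow, so it
  suffices to find a cell around \<open>p\<close> on which every maximizer at \<open>p\<close>
  remains one. The same cell serves all \<open>\<Phi>\<close> simultaneously.\<close>

lemma ex_small_covector_cell:
  assumes p: "p \<in> TP_min d"
  shows "\<exists>C\<in>covector_cells d n V. p \<in> C \<and>
    (\<forall>\<Phi>. p \<in> closed_thalf d n V \<Phi> \<longrightarrow> C \<subseteq> closed_thalf d n V \<Phi>)"
proof -
  obtain x where x: "x \<in> trop_vecs' {1..d}" "p = point d x" using p by (auto simp: TP_min_eq)
  have x_trop: "x \<in> trop_vecs {1..d}" using x(1) by (simp add: trop_vecs'_def)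
  define Z where "Z = {l \<in> {1..d}. x l = \<infinity>}"
  let ?R = "{1..d} - Z" and ?J = "kept_columns n V Z"
  define y where "y = restrict x ?R"
  have undef: "x l = undefined" if "l \<notin> {1..d}" for l
    using x_trop that unfolding trop_vecs_def by (rule PiE_arb)
  have Z: "Z \<subset> {1..d}"
  proof -
    have "Z \<noteq> {1..d}"
    proof
      assume Z_all: "Z = {1..d}"
      have "x = (\<lambda>l\<in>{1..d}. \<infinity>)"
      proof
        fix l
        have "x l = \<infinity>" if "l \<in> {1..d}" using that Z_all unfolding Z_def by blast
        then show "x l = (\<lambda>l\<in>{1..d}. \<infinity>) l" using undef[of l] by simp
      qed
      then show False using x(1) by (simp add: trop_vecs'_def)
    qed
    then show ?thesis by (auto simp: Z_def)
  qed
  have y: "y \<in> real_vecs ?R"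
    unfolding real_vecs_def
  proof (rule PiE_I)
    fix l assume l: "l \<in> ?R"
    then show "y l \<in> range ereal"
      using trop_vecs_entry[OF x_trop, of l] by (cases "x l") (auto simp: y_def Z_def)
  qed (auto simp: y_def)
  have x_eq: "x = extend_inf d Z y"
  proof
    fix l
    show "x l = extend_inf d Z y l"
      using undef[of l] by (simp add: extend_inf_def y_def Z_def)
  qed
  \<comment> \<open>For a kept column, \<open>c j\<close> is the intersection of all sectors of that
    column containing \<open>y\<close>.\<close>
  define c where "c j = {z \<in> real_vecs ?R. maximizers ?R (column ?R V j) y
      \<subseteq> maximizers ?R (column ?R V j) z}" for j
  define C where "C = real_vecs ?R \<inter> (\<Inter>j\<in>?J. c j)"
  have yC: "y \<in> C" using y by (auto simp: C_def c_def)
  have "c j \<in> sector_complex ?R (column ?R V j)" if j: "j \<in> ?J" for j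
  proof -
    have jn: "j \<in> {1..n}" using j by (auto simp: kept_columns_def)
    then obtain i where i: "i \<in> {1..d}" "V i j \<noteq> \<infinity>" using columns by blast
    \<comment> \<open>A kept column has no finite entry in the rows of \<open>Z\<close>, so its
      finite entry survives their removal.\<close>
    then have "i \<in> supp ?R (column ?R V j)" using j by (auto simp: kept_columns_def supp_column)
    moreover have u: "column ?R V j \<in> trop_vecs ?R"
      using column_trop_vecs[of ?R "{1..d}"] entries jn by blast
    ultimately have "maximizers ?R (column ?R V j) y \<noteq> {}"
      using y real_vecs_subset_trop_vecs by (intro maximizers_nonempty) auto
    then show ?thesis
      unfolding c_def using u by (intro maximal_set_in_sector_complex) (auto simp: maximizers_def)
  qed
  then have C_cell: "C \<in> real_covector_cells ?R ?J V"
    using yC C_def unfolding real_covector_cells_def by blast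
  have C_real: "C \<subseteq> real_vecs ?R" by (simp add: C_def)
  let ?C = "(\<lambda>y. point d (extend_inf d Z y)) ` C"
  have "?C \<in> covector_cells d n V"
    using mod_ones_extend_inf[OF Z C_real] C_cell Z unfolding covector_cells_def by blast
  moreover have "p \<in> ?C" using x(2) x_eq yC by blast
  moreover have "?C \<subseteq> closed_thalf d n V \<Phi>" if \<Phi>: "p \<in> closed_thalf d n V \<Phi>" for \<Phi>
  proof
    fix q assume "q \<in> ?C"
    then obtain z where z: "z \<in> C" "q = point d (extend_inf d Z z)" by blast
    have zr: "z \<in> real_vecs ?R" using z C_real by blast
    \<comment> \<open>For removed columns the two sets coincide, since both points lie in the same
      stratum; for kept columns the inclusion is the definition of \<open>c j\<close>.\<close>
    have "col_maximizers j x \<subseteq> col_maximizers j (extend_inf d Z z)" if j: "j \<in> {1..n}" for j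
    proof -
      have "maximizers ?R (column ?R V j) y \<subseteq> maximizers ?R (column ?R V j) z" if "j \<in> ?J"
        using z(1) that by (auto simp: C_def c_def)
      then show ?thesis
        using maximizers_extend_inf[OF entries j _ y] maximizers_extend_inf[OF entries j _ zr] Z x_eq
        by auto
    qed
    then show "q \<in> closed_thalf d n V \<Phi>"
      using \<Phi> unfolding x(2) z(2) point_in_closed_thalf_iff[OF x(1)]
        point_in_closed_thalf_iff[OF extend_inf_trop_vecs'[OF Z zr]]
      by blast
  qed
  ultimately show ?thesis by (intro bexI[of _ ?C]) auto
qed

lemma signed_cells_cover: "\<Union>(signed_cells d n V \<Psi>) = TP_min d"
proof
  show "\<Union>(signed_cells d n V \<Psi>) \<subseteq> TP_min d"
    by (auto simp: signed_cells_def closed_thalf_def)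
  show "TP_min d \<subseteq> \<Union>(signed_cells d n V \<Psi>)"
  proof
    fix p assume "p \<in> TP_min d"
    then obtain x where x: "x \<in> trop_vecs' {1..d}" "p = point d x" by (auto simp: TP_min_eq)
    have "col_maximizers j x \<noteq> {}" if j: "j \<in> {1..n}" for j
    proof (rule maximizers_nonempty)
      show "column {1..d} V j \<in> trop_vecs {1..d}"
        using column_trop_vecs[of "{1..d}" "{1..d}"] entries j by blast
      show "supp {1..d} (column {1..d} V j) \<noteq> {}" using columns j unfolding supp_column by blast
      show "x \<in> trop_vecs {1..d}" using x(1) by (simp add: trop_vecs'_def)
    qed simp
    then obtain m where m: "\<And>j. j \<in> {1..n} \<Longrightarrow> m j \<in> col_maximizers j x"
      unfolding ex_in_conv[symmetric] by metis
    \<comment> \<open>The sign at \<open>j\<close> selects \<open>\<Psi>\<close> or its complement,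
      whichever contains the arc from the chosen maximizer \<open>m j\<close>.\<close>
    define \<epsilon> where "\<epsilon> = (\<lambda>j\<in>{1..n}. if (m j, j) \<in> \<Psi> then Plus else Minus)"
    have "(m j, j) \<in> signed_graph d n \<Psi> \<epsilon>" if "j \<in> {1..n}" for j
      using m[OF that] that by (auto simp: signed_graph_def \<epsilon>_def maximizers_def supp_def)
    then have "p \<in> closed_thalf d n V (signed_graph d n \<Psi> \<epsilon>)"
      using m point_in_closed_thalf_iff[OF x(1)] x(2) by blast
    moreover have "\<epsilon> \<in> sign_vecs n" by (simp add: sign_vecs_def \<epsilon>_def)
    ultimately show "p \<in> \<Union>(signed_cells d n V \<Psi>)" by (auto simp: signed_cells_def)
  qed
qed

text \<open>The small cell around a point lies in every member of \<open>\<T>\<close> containing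
  that point, hence in the whole intersection.\<close>

lemma Inter_signed_cells_eq_Union_covector_cells:
  assumes T: "\<T> \<subseteq> signed_cells d n V \<Psi>" "\<T> \<noteq> {}"
  shows "\<exists>\<D>\<subseteq>covector_cells d n V. \<Inter>\<T> = \<Union>\<D>"
proof (intro exI conjI)
  let ?D = "{C \<in> covector_cells d n V. C \<subseteq> \<Inter>\<T>}"
  have "p \<in> \<Union>?D" if p: "p \<in> \<Inter>\<T>" for p
  proof -
    have "p \<in> TP_min d" using p T signed_cells_cover by blast
    then obtain C where "C \<in> covector_cells d n V" "p \<in> C"
      "\<And>\<Phi>. p \<in> closed_thalf d n V \<Phi> \<Longrightarrow> C \<subseteq> closed_thalf d n V \<Phi>"
      using ex_small_covector_cell by blast
    moreover have "\<exists>\<Phi>. S = closed_thalf d n V \<Phi>" if "S \<in> \<T>" for S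
      using that T(1) by (auto simp: signed_cells_def)
    ultimately show ?thesis using p by blast
  qed
  then show "\<Inter>\<T> = \<Union>?D" by blast
qed blast

end

theorem corollary53:
  fixes d n :: nat
    and V :: "nat \<Rightarrow> nat \<Rightarrow> ereal"
    and \<Psi> :: "(nat \<times> nat) set"
  assumes entries: "\<forall>i\<in>{1..d}. \<forall>j\<in>{1..n}. V i j \<in> T_min"
    and columns: "\<forall>j\<in>{1..n}. \<exists>i\<in>{1..d}. V i j \<noteq> \<infinity>"
    and subgraph: "\<Psi> \<subseteq> {1..d} \<times> {1..n}"
  shows "generates_pl_decomposition (signed_cells d n V \<Psi>) (covector_cells d n V) (TP_min d) \<and>
    (\<forall>\<epsilon>\<in>sign_vecs n. \<forall>C\<in>covector_cells d n V. \<forall>G. G = cell_graph d n V C \<longrightarrow>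
       (C \<subseteq> closed_thalf d n V (signed_graph d n \<Psi> \<epsilon>) \<longleftrightarrow>
        \<not> (\<exists>j\<in>{1..n}. isolated_column_node (signed_graph d n \<Psi> \<epsilon> \<inter> G) j)))"
proof (intro conjI ballI allI impI)
  note Int = Inter_signed_cells_eq_Union_covector_cells[OF entries columns]
  \<comment> \<open>A single signed cell is the intersection of a one-element family.\<close>
  have "\<exists>\<D>\<subseteq>covector_cells d n V. S = \<Union>\<D>" if "S \<in> signed_cells d n V \<Psi>" for S
    using Int[of "{S}" \<Psi>] that by simp
  then show "generates_pl_decomposition (signed_cells d n V \<Psi>) (covector_cells d n V) (TP_min d)"
    using Int signed_cells_cover[OF entries columns] by (simp add: generates_pl_decomposition_def)
next
  fix \<epsilon> C G
  assume C: "C \<in> covector_cells d n V" and G: "G = cell_graph d n V C"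
  have "signed_graph d n \<Psi> \<epsilon> \<subseteq> {1..d} \<times> {1..n}" by (auto simp: signed_graph_def)
  then show "C \<subseteq> closed_thalf d n V (signed_graph d n \<Psi> \<epsilon>) \<longleftrightarrow>
        \<not> (\<exists>j\<in>{1..n}. isolated_column_node (signed_graph d n \<Psi> \<epsilon> \<inter> G) j)"
    unfolding G by (rule covector_cell_subset_closed_thalf_iff[OF entries columns C])
qed

end
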